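(* Let $q$ be a prime power and $P$ a finite poset. Then for all sufficiently large $n$, \[ \mathrm{La}_q(n,P)\le\left(\frac{|P|+h(P)}{2}-1\right)\begin{bmatrix} n\\ \lfloor n/2\rfloor\end{bmatrix}_q . \]
   Context: $|P|$ is the number of elements of $P$ and $h(P)$ is the number of elements in a longest chain of $P$. A poset $P$ is a subposet of $Q$ if there is an injection $\phi:P\to Q$ with $x\le_P y\Rightarrow\phi(x)\le_Q\phi(y)$. $\mathrm{La}_q(n,P)$ is the maximum size of a family of subspaces (ordered by inclusion) of an $n$-dimensional vector space over $\mathbb{F}_q$ not containing $P$ as a subposet. $\begin{bmatrix} n\\ k\end{bmatrix}_q=\prod_{0\le i<k}\frac{q^{n-i}-1}{q^{k-i}-1}$. *)

theory Defs
  imports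
    "HOL-Analysis.Analysis"
    "HOL-Library.Function_Algebras"
    "HOL-Number_Theory.Prime_Powers"
begin

definition height :: "'p set \<Rightarrow> 'p rel \<Rightarrow> nat" where
  "height P le = Max (card ` {C \<in> Chains le. C \<subseteq> P})"

text \<open>Weak (not necessarily induced) containment: incomparable elements may be sent to comparable ones.\<close>

definition is_subposet :: "'p set \<Rightarrow> 'p rel \<Rightarrow> 'b set \<Rightarrow> 'b rel \<Rightarrow> bool" where
  "is_subposet P leP Q leQ \<longleftrightarrow>
    (\<exists>\<phi>. inj_on \<phi> P \<and> \<phi> ` P \<subseteq> Q \<and>
         (\<forall>x\<in>P. \<forall>y\<in>P. (x, y) \<in> leP \<longrightarrow> (\<phi> x, \<phi> y) \<in> leQ))"

text \<open>The \<open>n\<close>-dimensional space \<open>F\<^sup>n\<close> over a field \<open>F\<close> is represented by the functions from \<open>nat\<close>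
  to \<open>F\<close> that vanish at every index \<open>i \<ge> n\<close>, with pointwise operations.\<close>

definition fscale :: "'a::field \<Rightarrow> (nat \<Rightarrow> 'a) \<Rightarrow> nat \<Rightarrow> 'a" where
  "fscale c v = (\<lambda>i. c * v i)"

interpretation fvs: vector_space fscale
  by unfold_locales (auto simp: fscale_def algebra_simps)

definition coord_space :: "nat \<Rightarrow> (nat \<Rightarrow> 'a::field) set" where
  "coord_space n = {v. \<forall>i\<ge>n. v i = 0}"

definition subspaces :: "nat \<Rightarrow> (nat \<Rightarrow> 'a::field) set set" where
  "subspaces n = {W. fvs.subspace W \<and> W \<subseteq> coord_space n}"

lemma subspace_coord_space: "fvs.subspace (coord_space n)"
  by (auto simp: fvs.subspace_def coord_space_def fscale_def)

lemma dim_coord_space: "fvs.dim (coord_space n :: (nat \<Rightarrow> 'a::field) set) = n"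
proof -
  define e :: "nat \<Rightarrow> nat \<Rightarrow> 'a" where "e = (\<lambda>i j. if j = i then 1 else 0)"
  have inj: "inj_on e {..<n}"
    by (rule inj_onI) (metis e_def one_neq_zero)
  have sum_e: "(\<Sum>i<n. fscale (c i) (e i)) = (\<lambda>j. if j < n then c j else 0)" for c
  proof
    fix j
    have "(\<Sum>i<n. fscale (c i) (e i)) j = (\<Sum>i<n. c i * e i j)"
      by (induction n) (auto simp: fscale_def)
    also have "\<dots> = (if j < n then c j else 0)"
      by (simp add: e_def if_distrib cong: if_cong)
    finally show "(\<Sum>i<n. fscale (c i) (e i)) j = (if j < n then c j else 0)" .
  qed
  have ind: "fvs.independent (e ` {..<n})"
  proof (rule fvs.independent_if_scalars_zero)
    fix f x assume "(\<Sum>x\<in>e ` {..<n}. fscale (f x) x) = 0" and x: "x \<in> e ` {..<n}"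
    then have "(\<Sum>i<n. fscale (f (e i)) (e i)) = 0"
      by (simp add: sum.reindex[OF inj])
    then have "(\<lambda>j. if j < n then f (e j) else 0) = (\<lambda>j. 0)"
      unfolding sum_e by (simp add: zero_fun_def)
    then show "f x = 0"
      using x by (auto dest: fun_cong split: if_splits)
  qed simp
  have span: "coord_space n \<subseteq> fvs.span (e ` {..<n})"
  proof
    fix v :: "nat \<Rightarrow> 'a" assume "v \<in> coord_space n"
    then have "v = (\<Sum>i<n. fscale (v i) (e i))"
      unfolding sum_e by (auto simp: coord_space_def fun_eq_iff)
    also have "\<dots> \<in> fvs.span (e ` {..<n})"
      by (intro fvs.span_sum fvs.span_scale fvs.span_base) auto
    finally show "v \<in> fvs.span (e ` {..<n})" .
  qed
  have "e ` {..<n} \<subseteq> coord_space n"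
    by (auto simp: e_def coord_space_def)
  then show ?thesis
    using fvs.dim_unique[OF _ span ind, of n] by (simp add: card_image[OF inj])
qed

lemma finite_subspaces: "finite (subspaces n :: (nat \<Rightarrow> 'a::{field,finite}) set set)"
proof -
  have "coord_space n \<subseteq> (\<lambda>f i. if i < n then f i else (0 :: 'a)) ` ({..<n} \<rightarrow>\<^sub>E (UNIV :: 'a set))"
  proof
    fix v :: "nat \<Rightarrow> 'a" assume "v \<in> coord_space n"
    then have "v = (\<lambda>i. if i < n then restrict v {..<n} i else 0)"
      by (auto simp: coord_space_def fun_eq_iff)
    then show "v \<in> (\<lambda>f i. if i < n then f i else (0 :: 'a)) ` ({..<n} \<rightarrow>\<^sub>E UNIV)"
      by (rule image_eqI[where x = "restrict v {..<n}"]) auto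
  qed
  then have "finite (coord_space n :: (nat \<Rightarrow> 'a) set)"
    by (rule finite_subset) (intro finite_imageI finite_PiE finite_lessThan finite)
  then have "finite (Pow (coord_space n :: (nat \<Rightarrow> 'a) set))" by simp
  then show ?thesis by (rule rev_finite_subset) (auto simp: subspaces_def)
qed

definition La_q :: "'a::{field,finite} itself \<Rightarrow> nat \<Rightarrow> 'p set \<Rightarrow> 'p rel \<Rightarrow> nat" where
  "La_q _ n P le =
    Max (card ` {\<F>. \<F> \<subseteq> (subspaces n :: (nat \<Rightarrow> 'a) set set) \<and>
                     \<not> is_subposet P le \<F> (relation_of (\<subseteq>) \<F>)})"

text \<open>For \<open>k \<le> n\<close> no subtraction below is truncated.\<close>

definition gauss_binomial :: "nat \<Rightarrow> nat \<Rightarrow> nat \<Rightarrow> real" where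
  "gauss_binomial q n k = (\<Prod>i<k. (real q ^ (n - i) - 1) / (real q ^ (k - i) - 1))"

end

theory Submission
  imports Defs
begin

text \<open>An ordered basis \<open>e\<^sub>1, \<dots>, e\<^sub>n\<close> spans a double chain: the subspaces
  \<open>A\<^sub>i = \<langle>e\<^sub>1, \<dots>, e\<^sub>i\<rangle>\<close> for \<open>0 \<le> i \<le> n\<close> and
  \<open>B\<^sub>i = \<langle>e\<^sub>1, \<dots>, e\<^sub>i\<^sub>-\<^sub>1, e\<^sub>i\<^sub>+\<^sub>1\<rangle>\<close> for \<open>0 < i < n\<close>. The only incomparable pairs are
  \<open>A\<^sub>i, B\<^sub>i\<close> and \<open>B\<^sub>i, B\<^sub>i\<^sub>+\<^sub>1\<close>, so embedding \<open>P\<close> greedily, one rank level after the other,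
  wastes at most one member between consecutive levels. Hence \<open>|P| + h(P) - 1\<close> members of a double
  chain always contain \<open>P\<close>, and a \<open>P\<close>-free family has at most \<open>|P| + h(P) - 2\<close> members in each
  double chain. Averaging over all ordered bases, a subspace of dimension \<open>0 < i < n\<close> is hit with
  expectation \<open>2\<close> over the Gaussian binomial coefficient of \<open>n\<close> and \<open>i\<close>, and each of the two trivial
  subspaces with expectation \<open>1\<close>; all of these are at least \<open>2\<close> over the middle coefficient.\<close>

section \<open>Embedding posets into the double chain\<close>

text \<open>The number \<open>2 i\<close> stands for \<open>A\<^sub>i\<close> and \<open>2 i - 1\<close> for \<open>B\<^sub>i\<close>.\<close>


definition double_chain_less :: "nat \<Rightarrow> nat \<Rightarrow> bool" where
  "double_chain_less a b \<longleftrightarrow> (if even a then a < b else a + 2 < b)"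

lemma double_chain_less_imp_less: "double_chain_less a b \<Longrightarrow> a < b"
  by (auto simp: double_chain_less_def split: if_splits)

lemma obtain_initial_segment:
  fixes S :: "'a::linorder set"
  assumes "finite S" "s \<le> card S"
  obtains L where "L \<subseteq> S" "card L = s" "\<And>x y. x \<in> L \<Longrightarrow> y \<in> S - L \<Longrightarrow> x < y"
proof -
  have "\<exists>L\<subseteq>S. card L = s \<and> (\<forall>x\<in>L. \<forall>y\<in>S - L. x < y)"
    using assms(2)
  proof (induction s)
    case 0
    then show ?case by (intro exI[of _ "{}"]) auto
  next
    case (Suc s)
    then obtain L where L: "L \<subseteq> S" "card L = s" "\<forall>x\<in>L. \<forall>y\<in>S - L. x < y" by auto
    define a where "a = Min (S - L)"
    have "S - L \<noteq> {}" using L Suc.prems by auto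
    then have a: "a \<in> S - L" "\<And>y. y \<in> S - L \<Longrightarrow> a \<le> y"
      using Min_in[of "S - L"] assms(1) by (auto simp: a_def)
    have "finite L" using L(1) assms(1) finite_subset by blast
    moreover have "a < y" if "y \<in> S - insert a L" for y
      using a(2)[of y] that by (auto intro: le_neq_trans)
    ultimately show ?case
      using a(1) L by (intro exI[of _ "insert a L"]) auto
  qed
  then show thesis using that by blast
qed

text \<open>If the \<open>s\<close>-th element is a \<open>B\<^sub>i\<close> and \<open>A\<^sub>i\<close> lies in \<open>S\<close>, taking \<open>A\<^sub>i\<close> in its place leaves \<open>B\<^sub>i\<close>
  as the only wasted element.\<close>

lemma double_chain_split:
  assumes S: "finite S" and s: "s \<le> card S"
  obtains L S' where "L \<subseteq> S" "S' \<subseteq> S" "card L = s" "card S \<le> card S' + s + 1"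
    "\<And>x y. x \<in> L \<Longrightarrow> y \<in> S' \<Longrightarrow> double_chain_less x y"
proof -
  obtain L where L: "L \<subseteq> S" "card L = s" "\<And>x y. x \<in> L \<Longrightarrow> y \<in> S - L \<Longrightarrow> x < y"
    using obtain_initial_segment[OF S s] by metis
  have finL: "finite L" using L(1) S finite_subset by blast
  have cd: "card (S - L) = card S - s" using L finL by (simp add: card_Diff_subset)
  have drop: "card S \<le> card (S - L - {z}) + s + 1" for z
  proof -
    have "card (S - L) - 1 \<le> card (S - L - {z})"
      using S by (simp add: card_Diff_singleton_if)
    then show ?thesis using cd by linarith
  qed
  show thesis
  proof (cases "L = {}")
    case True
    then show thesis using that[of "{}" S] L by auto
  next
    case False
    define t where "t = Max L"
    have t: "t \<in> L" "\<And>x. x \<in> L \<Longrightarrow> x \<le> t" using finL False by (auto simp: t_def)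
    have gt: "t < y" if "y \<in> S - L" for y using L(3) t(1) that by blast
    show thesis
    proof (cases "even t")
      case True
      \<comment> \<open>Everything beyond \<open>t\<close> lies above \<open>t\<close> itself, but
        the odd code \<open>t - 1\<close> may be in \<open>L\<close>, and it is incomparable with
        \<open>t + 1\<close>.\<close>
      show thesis
      proof (rule that[of L "S - L - {t + 1}"])
        fix x y assume x: "x \<in> L" and y: "y \<in> S - L - {t + 1}"
        have "x \<le> t" "t + 1 < y" using t x gt[of y] y by (auto simp: less_Suc_eq Suc_lessI)
        then show "double_chain_less x y"
          using True by (cases "x = t") (auto simp: double_chain_less_def)
      qed (use L drop in auto)
    next
      case odd: False
      show thesis
      proof (cases "t + 1 \<in> S")
        case True
        then have new: "t + 1 \<in> S - L" using t(2)[of "t + 1"] by auto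
        show thesis
        proof (rule that[of "insert (t + 1) (L - {t})" "S - L - {t + 1}"])
          show "card (insert (t + 1) (L - {t})) = s"
            using new finL t(1) L(2) by (metis DiffD2 card_Suc_Diff1 card_insert_disjoint
                finite_Diff insertCI insert_Diff)
          fix x y assume x: "x \<in> insert (t + 1) (L - {t})" and y: "y \<in> S - L - {t + 1}"
          have y': "t + 1 < y" using gt[of y] y by (auto simp: Suc_lessI)
          show "double_chain_less x y"
          proof (cases "x = t + 1")
            case True
            then show ?thesis using odd y' by (simp add: double_chain_less_def)
          next
            case False
            then have "x < t" using x t(2) by (auto simp: le_neq_implies_less)
            then show ?thesis using odd y' by (cases "x + 1 = t") (auto simp: double_chain_less_def)
          qed
        qed (use L new drop[of "t + 1"] in auto)
      next
        case False
        \<comment> \<open>With \<open>t + 1\<close> absent, only \<open>t + 2\<close> among the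
          larger elements can fail to lie above \<open>t\<close>.\<close>
        show thesis
        proof (rule that[of L "S - L - {t + 2}"])
          fix x y assume x: "x \<in> L" and y: "y \<in> S - L - {t + 2}"
          have "t < y" "y \<noteq> t + 1" "y \<noteq> t + 2" using gt[of y] y False by auto
          then have "t + 2 < y" by linarith
          then show "double_chain_less x y"
            using t(2)[OF x] by (auto simp: double_chain_less_def)
        qed (use L drop in auto)
      qed
    qed
  qed
qed

text \<open>Induction on the number of levels: the elements of rank 0 go to \<open>L\<close>, the
  others into \<open>S'\<close>. Each split wastes at most one element, and the hypothesis on
  \<open>card S\<close> pays for the \<open>h - 1\<close> gaps between \<open>h\<close> levels,
  since nothing has to follow the last one.\<close>

lemma double_chain_embedding_graded:
  fixes r :: "'p \<Rightarrow> nat"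
  assumes "finite P" "finite S" "card P + h \<le> card S + 1"
    and "\<And>x. x \<in> P \<Longrightarrow> r x < h"
    and "\<And>x y. x \<in> P \<Longrightarrow> y \<in> P \<Longrightarrow> lt x y \<Longrightarrow> r x < r y"
  shows "\<exists>\<phi>. inj_on \<phi> P \<and> \<phi> ` P \<subseteq> S \<and>
    (\<forall>x\<in>P. \<forall>y\<in>P. lt x y \<longrightarrow> double_chain_less (\<phi> x) (\<phi> y))"
  using assms
proof (induction h arbitrary: P S r)
  case 0
  then have "P = {}" by auto
  then show ?case by auto
next
  case (Suc h)
  define P0 P1 where "P0 = {x \<in> P. r x = 0}" and "P1 = {x \<in> P. r x \<noteq> 0}"
  have P: "P = P0 \<union> P1" "P0 \<inter> P1 = {}" by (auto simp: P0_def P1_def)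
  have fin: "finite P0" "finite P1" using Suc.prems(1) by (auto simp: P0_def P1_def)
  have cP: "card P = card P0 + card P1" using P fin by (simp add: card_Un_disjoint)
  then have "card P0 \<le> card S" using Suc.prems(3) by linarith
  then obtain L S' where L: "L \<subseteq> S" "S' \<subseteq> S" "card L = card P0" "card S \<le> card S' + card P0 + 1"
    "\<And>x y. x \<in> L \<Longrightarrow> y \<in> S' \<Longrightarrow> double_chain_less x y"
    using double_chain_split[OF Suc.prems(2)] by metis
  have finL: "finite L" "finite S'" using L Suc.prems(2) finite_subset by blast+
  \<comment> \<open>Elements of rank 0 are pairwise unrelated by \<open>lt\<close>, so any bijection
    will do.\<close>
  obtain f where f: "bij_betw f P0 L" using finite_same_card_bij[OF fin(1) finL(1)] L(3) by auto
  have "\<exists>\<phi>. inj_on \<phi> P1 \<and> \<phi> ` P1 \<subseteq> S' \<and>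
    (\<forall>x\<in>P1. \<forall>y\<in>P1. lt x y \<longrightarrow> double_chain_less (\<phi> x) (\<phi> y))"
  proof (rule Suc.IH[where r = "\<lambda>x. r x - 1"])
    show "card P1 + h \<le> card S' + 1" using cP L(4) Suc.prems(3) by linarith
    show "r x - 1 < h" if "x \<in> P1" for x
      using Suc.prems(4)[of x] that by (auto simp: P1_def)
    show "r x - 1 < r y - 1" if "x \<in> P1" "y \<in> P1" "lt x y" for x y
      using Suc.prems(5)[of x y] that by (auto simp: P1_def)
  qed (use fin finL in auto)
  then obtain g where g: "inj_on g P1" "g ` P1 \<subseteq> S'"
    "\<And>x y. x \<in> P1 \<Longrightarrow> y \<in> P1 \<Longrightarrow> lt x y \<Longrightarrow> double_chain_less (g x) (g y)" by blast
  define \<phi> where "\<phi> x = (if x \<in> P0 then f x else g x)" for x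
  have \<phi>0: "\<phi> x = f x" "f x \<in> L" if "x \<in> P0" for x
    using that f by (auto simp: \<phi>_def bij_betw_def)
  have \<phi>1: "\<phi> x = g x" "g x \<in> S'" if "x \<in> P1" for x
    using that g(2) P(2) by (auto simp: \<phi>_def)
  have less: "double_chain_less (\<phi> x) (\<phi> y)" if "x \<in> P0" "y \<in> P1" for x y
    using that \<phi>0 \<phi>1 L(5) by simp
  have "inj_on \<phi> P"
    unfolding P(1)
  proof (rule inj_on_Un[THEN iffD2], intro conjI)
    show "inj_on \<phi> P0" using f \<phi>0 by (auto simp: bij_betw_def inj_on_def)
    show "inj_on \<phi> P1" using g \<phi>1 by (auto simp: inj_on_def)
    show "\<phi> ` (P0 - P1) \<inter> \<phi> ` (P1 - P0) = {}"
    proof (rule ccontr)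
      assume "\<phi> ` (P0 - P1) \<inter> \<phi> ` (P1 - P0) \<noteq> {}"
      then obtain x y where "x \<in> P0" "y \<in> P1" "\<phi> x = \<phi> y" by auto
      with less[of x y] show False by (auto dest: double_chain_less_imp_less)
    qed
  qed
  moreover have "\<phi> ` P \<subseteq> S" using P \<phi>0 \<phi>1 L by auto
  moreover have "double_chain_less (\<phi> x) (\<phi> y)" if "x \<in> P" "y \<in> P" "lt x y" for x y
  proof (cases "x \<in> P0")
    case True
    have "y \<in> P1" using Suc.prems(5)[OF that] that(2) by (auto simp: P1_def)
    with True less show ?thesis by blast
  next
    case False
    then have "x \<in> P1" "y \<in> P1" using Suc.prems(5)[OF that] that by (auto simp: P0_def P1_def)
    with g \<phi>1 that show ?thesis by simp
  qed
  ultimately show ?case by blast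
qed

text \<open>The rank of \<open>x\<close> is the size of a largest chain strictly below
  \<open>x\<close>. Adding \<open>x\<close> gives a chain of \<open>P\<close>, which keeps the rank
  below the height, and for \<open>y\<close> above \<open>x\<close> it gives a chain strictly below
  \<open>y\<close>, which makes the rank increase.\<close>

lemma height_grading:
  assumes "finite P" "partial_order_on P le"
  obtains r where "\<And>x. x \<in> P \<Longrightarrow> r x < height P le"
    "\<And>x y. (x, y) \<in> le \<Longrightarrow> x \<noteq> y \<Longrightarrow> r x < (r y :: nat)"
proof -
  have le: "le \<subseteq> P \<times> P" "\<And>x. x \<in> P \<Longrightarrow> (x, x) \<in> le"
    "\<And>x y z. (x, y) \<in> le \<Longrightarrow> (y, z) \<in> le \<Longrightarrow> (x, z) \<in> le"
    "\<And>x y. (x, y) \<in> le \<Longrightarrow> (y, x) \<in> le \<Longrightarrow> x = y"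
    using assms(2) by (auto simp: partial_order_on_def preorder_on_def refl_on_def antisym_def
        dest: transD)
  define below where "below x = {C \<in> Chains le. C \<subseteq> P \<and> (\<forall>c\<in>C. (c, x) \<in> le \<and> c \<noteq> x)}" for x
  define r where "r x = Max (card ` below x)" for x
  have fin: "finite (below x)" for x
    using assms(1) by (auto simp: below_def intro: finite_subset[of _ "Pow P"])
  have "{} \<in> below x" for x by (auto simp: below_def Chains_def)
  then have "r x \<in> card ` below x" for x
    unfolding r_def using fin by (intro Max_in) auto
  then have wit: "\<exists>C. C \<in> below x \<and> r x = card C" for x by auto
  have ins: "insert x C \<in> Chains le" "card (insert x C) = Suc (card C)"
    if "x \<in> P" "C \<in> below x" for x C
  proof -
    have "finite C" "x \<notin> C" using that assms(1) finite_subset by (auto simp: below_def)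
    then show "card (insert x C) = Suc (card C)" by simp
    show "insert x C \<in> Chains le" using that le(2) by (auto simp: below_def Chains_def)
  qed
  show thesis
  proof (rule that[of r])
    fix x assume x: "x \<in> P"
    obtain C where C: "C \<in> below x" "r x = card C" using wit by blast
    have "card (insert x C) \<le> height P le"
      unfolding height_def
      using assms(1) ins[OF x C(1)] x C
      by (intro Max_ge finite_imageI imageI)
        (auto simp: below_def intro: finite_subset[of _ "Pow P"])
    then show "r x < height P le" using C ins[OF x C(1)] by simp
  next
    fix x y assume xy: "(x, y) \<in> le" "x \<noteq> y"
    then have x: "x \<in> P" using le by auto
    obtain C where C: "C \<in> below x" "r x = card C" using wit by blast
    have "insert x C \<in> below y"
    proof -
      have "(c, y) \<in> le \<and> c \<noteq> y" if "c \<in> C" for c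
        using that C(1) le(3,4) xy unfolding below_def by blast
      then show ?thesis
        using ins(1)[OF x C(1)] C(1) xy x unfolding below_def by blast
    qed
    then have "card (insert x C) \<le> r y" unfolding r_def using fin by auto
    then show "r x < r y" using C ins[OF x C(1)] by simp
  qed
qed

text \<open>The indices, counted from \<open>0\<close>, of the basis vectors spanning the member coded by \<open>m\<close>.\<close>

definition double_chain_index :: "nat \<Rightarrow> nat set" where
  "double_chain_index m = (if even m then {..<m div 2} else insert (m div 2 + 1) {..<m div 2})"

text \<open>The code of \<open>B\<^sub>i\<close> is followed by those of \<open>A\<^sub>i\<close>
  and \<open>B\<^sub>i\<^sub>+\<^sub>1\<close>, the only later members not containing it; hence the
  offset 2 in \<open>double_chain_less\<close>.\<close>

lemma double_chain_index_mono:
  "double_chain_less a b \<Longrightarrow> double_chain_index a \<subseteq> double_chain_index b"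
  unfolding double_chain_less_def double_chain_index_def
  by (cases "even a"; cases "even b") (auto elim!: evenE oddE)

text \<open>The cardinality is the level \<open>i\<close>, and of the two members of that level only
  \<open>B\<^sub>i\<close> uses the index \<open>i\<close>.\<close>

lemma inj_double_chain_index: "inj double_chain_index"
proof (rule injI)
  fix a b assume eq: "double_chain_index a = double_chain_index b"
  have card: "card (double_chain_index m) = (m + 1) div 2" for m
    by (auto simp: double_chain_index_def elim!: evenE oddE)
  have top: "(m + 1) div 2 \<in> double_chain_index m \<longleftrightarrow> odd m" for m
    by (auto simp: double_chain_index_def elim!: evenE oddE)
  have "(a + 1) div 2 = (b + 1) div 2" "odd a = odd b"
    using eq card[of a] card[of b] top[of a] top[of b] by auto
  then show "a = b" by (auto elim!: evenE oddE)
qed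

section \<open>Counting frames\<close>

text \<open>The counting takes place in a finite subspace \<open>U\<close> of an arbitrary space
  over a finite field, where dimensions can be compared through cardinalities.\<close>

locale finite_field_space = vector_space scale
  for scale :: "'a::{field,finite} \<Rightarrow> 'b::ab_group_add \<Rightarrow> 'b"
begin

text \<open>As \<open>a\<close> is outside \<open>span B\<close>, the sums of a multiple of
  \<open>a\<close> and a vector of \<open>span B\<close> are all distinct, so each basis vector
  multiplies the count by \<open>CARD('a)\<close>.\<close>

lemma card_span:
  assumes "finite B" "independent B"
  shows "finite (span B)" "card (span B) = CARD('a) ^ card B"
proof -
  have "finite (span B) \<and> card (span B) = CARD('a) ^ card B"
    using assms
  proof (induction B)
    case empty
    then show ?case by simp
  next
    case (insert a B)
    then have a: "a \<notin> span B" and B: "independent B" by (auto simp: independent_insert)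
    have eq: "span (insert a B) = (\<lambda>(c, v). scale c a + v) ` (UNIV \<times> span B)"
    proof (intro equalityI subsetI)
      fix x assume "x \<in> span (insert a B)"
      then obtain k where "x - scale k a \<in> span B" by (auto simp: span_insert)
      then show "x \<in> (\<lambda>(c, v). scale c a + v) ` (UNIV \<times> span B)"
        by (intro image_eqI[of _ _ "(k, x - scale k a)"]) auto
    next
      fix x assume "x \<in> (\<lambda>(c, v). scale c a + v) ` (UNIV \<times> span B)"
      then obtain c v where "x = scale c a + v" "v \<in> span B" by auto
      then have "x - scale c a \<in> span B" by simp
      then show "x \<in> span (insert a B)" by (auto simp: span_insert)
    qed
    have "inj_on (\<lambda>(c, v). scale c a + v) (UNIV \<times> span B)"
    proof (rule inj_onI, clarify)
      fix c v c' v' assume v: "v \<in> span B" "v' \<in> span B" and eq: "scale c a + v = scale c' a + v'"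
      have "scale (c - c') a = v' - v"
        using eq by (simp add: scale_left_diff_distrib algebra_simps)
      then have "scale (c - c') a \<in> span B" using v span_diff by simp
      then have "c = c'" using a span_scale[of "scale (c - c') a" B "inverse (c - c')"]
        by (cases "c = c'") auto
      with eq show "c = c' \<and> v = v'" by simp
    qed
    then show ?case
      unfolding eq using insert B by (simp add: card_image card_cartesian_product)
  qed
  then show "finite (span B)" "card (span B) = CARD('a) ^ card B" by auto
qed

lemma card_subspace:
  assumes "subspace U" "finite U"
  shows "card U = CARD('a) ^ dim U"
proof -
  obtain B where B: "B \<subseteq> U" "independent B" "U \<subseteq> span B" "card B = dim U"
    by (rule basis_exists)
  then have "span B = U" using assms(1) span_minimal by blast
  then show ?thesis using card_span[OF _ B(2)] B assms(2) finite_subset by metis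
qed

lemma CARD_scalars_ge_2: "2 \<le> CARD('a)"
proof -
  have "card {0, 1 :: 'a} \<le> CARD('a)" by (rule card_mono) auto
  then show ?thesis by simp
qed

lemma dim_subspace_mono:
  assumes "subspace U" "finite U" "subspace W" "W \<subseteq> U"
  shows "dim W \<le> dim U"
proof -
  have "CARD('a) ^ dim W \<le> CARD('a) ^ dim U"
    using assms card_mono[OF assms(2,4)] card_subspace finite_subset by metis
  then show ?thesis using CARD_scalars_ge_2 by simp
qed

text \<open>For \<open>k = dim U\<close> these are the ordered bases of \<open>U\<close>; lists are
  used because a double chain depends on the order.\<close>

definition frames :: "'b set \<Rightarrow> nat \<Rightarrow> 'b list set" where
  "frames U k = {xs. length xs = k \<and> set xs \<subseteq> U \<and> distinct xs \<and> independent (set xs)}"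

lemma finite_frames: "finite U \<Longrightarrow> finite (frames U k)"
  by (rule finite_subset[OF _ finite_lists_length_eq[of U k]]) (auto simp: frames_def)

text \<open>Each further vector may be any one outside the span of the \<open>m + j\<close> vectors
  already present.\<close>

lemma card_frame_extensions:
  assumes "subspace U" "finite U" "us \<in> frames U m"
  shows "card {vs. us @ vs \<in> frames U (m + k)} = (\<Prod>j<k. card U - CARD('a) ^ (m + j))"
proof (induction k)
  case 0
  have "{vs. us @ vs \<in> frames U (m + 0)} = {[]}" using assms(3) by (auto simp: frames_def)
  then show ?case by simp
next
  case (Suc k)
  define E where "E = {vs. us @ vs \<in> frames U (m + k)}"
  have "finite ((@) us ` E)"
    by (rule finite_subset[OF _ finite_frames[OF assms(2), of "m + k"]]) (auto simp: E_def)
  then have finE: "finite E" by (rule finite_imageD) (auto simp: inj_on_def)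
  have "{vs. us @ vs \<in> frames U (m + Suc k)}
    = (\<lambda>(vs, v). vs @ [v]) ` (SIGMA vs:E. U - span (set (us @ vs)))" (is "?L = ?R")
  proof (intro equalityI subsetI)
    fix ws assume ws: "ws \<in> ?L"
    have len: "length ws = Suc k" using ws assms(3) by (auto simp: frames_def)
    then obtain vs v where vs: "ws = vs @ [v]" by (metis length_Suc_conv_rev)
    have "vs \<in> E" "v \<in> U - span (set (us @ vs))"
      using ws len unfolding vs E_def by (auto simp: frames_def independent_insert)
    then show "ws \<in> ?R" using vs by force
  next
    fix ws assume "ws \<in> ?R"
    then obtain vs v where "ws = vs @ [v]" "vs \<in> E" "v \<in> U" "v \<notin> span (set (us @ vs))" by auto
    then show "ws \<in> ?L"
      using span_base[of v "set (us @ vs)"] by (auto simp: E_def frames_def independent_insert)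
  qed
  moreover have "inj_on (\<lambda>(vs, v). vs @ [v]) (SIGMA vs:E. U - span (set (us @ vs)))"
    by (auto simp: inj_on_def)
  ultimately have "card ?L = (\<Sum>vs\<in>E. card (U - span (set (us @ vs))))"
    using finE assms(2) by (simp add: card_image)
  also have "\<dots> = (\<Sum>vs\<in>E. card U - CARD('a) ^ (m + k))"
  proof (rule sum.cong[OF refl])
    fix vs assume "vs \<in> E"
    then have f: "set (us @ vs) \<subseteq> U" "independent (set (us @ vs))" "card (set (us @ vs)) = m + k"
      using distinct_card[of "us @ vs"] by (auto simp: E_def frames_def)
    then show "card (U - span (set (us @ vs))) = card U - CARD('a) ^ (m + k)"
      using card_span[OF _ f(2)] span_minimal[OF f(1) assms(1)]
      by (simp add: card_Diff_subset)
  qed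
  also have "\<dots> = (\<Prod>j<Suc k. card U - CARD('a) ^ (m + j))"
    using Suc.IH by (simp add: E_def)
  finally show ?case .
qed

lemma card_frames:
  assumes "subspace U" "finite U"
  shows "card (frames U k) = (\<Prod>j<k. card U - CARD('a) ^ j)"
  using card_frame_extensions[OF assms, of "[]" 0 k] by (simp add: frames_def independent_empty)

lemma span_frame:
  assumes "subspace U" "finite U" "us \<in> frames U (dim U)"
  shows "span (set us) = U"
proof -
  have us: "set us \<subseteq> U" "independent (set us)" "card (set us) = dim U"
    using assms(3) distinct_card[of us] by (auto simp: frames_def)
  have "span (set us) \<subseteq> U" using us assms(1) span_minimal by blast
  moreover have "card (span (set us)) = card U"
    using card_span(2)[OF _ us(2)] us(3) card_subspace[OF assms(1,2)] by simp
  ultimately show ?thesis using assms(2) card_subset_eq by blast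
qed

text \<open>The left-hand side counts the pairs of an ordered basis of \<open>W\<close> and an
  extension of it to one of \<open>U\<close>. Concatenation is injective on them because the first
  part has fixed length.\<close>

lemma card_frames_initial_span:
  assumes "subspace U" "finite U" "subspace W" "W \<subseteq> U"
  shows "(\<Prod>j<dim W. card W - CARD('a) ^ j) * (\<Prod>j<dim U - dim W. card U - CARD('a) ^ (dim W + j))
    \<le> card {b \<in> frames U (dim U). span (set (take (dim W) b)) = W}" (is "?l \<le> card ?B")
proof -
  define i n where "i = dim W" and "n = dim U"
  have finW: "finite W" using assms finite_subset by blast
  have le: "i \<le> n" using dim_subspace_mono assms by (simp add: i_def n_def)
  define X where "X = (SIGMA us:frames W i. {vs. us @ vs \<in> frames U n})"
  have frW: "us \<in> frames U i" if "us \<in> frames W i" for us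
    using that assms(4) by (auto simp: frames_def)
  have ext: "card {vs. us @ vs \<in> frames U n} = (\<Prod>j<n - i. card U - CARD('a) ^ (i + j))"
    if "us \<in> frames W i" for us
    using card_frame_extensions[OF assms(1,2) frW[OF that], of "n - i"] le by simp
  have finE: "finite {vs. us @ vs \<in> frames U n}" for us
  proof -
    have "finite ((@) us ` {vs. us @ vs \<in> frames U n})"
      by (rule finite_subset[OF _ finite_frames[OF assms(2), of n]]) auto
    then show ?thesis by (rule finite_imageD) (auto simp: inj_on_def)
  qed
  have "card X = (\<Sum>us\<in>frames W i. card {vs. us @ vs \<in> frames U n})"
    unfolding X_def using finite_frames[OF finW] finE by simp
  also have "\<dots> = ?l"
    using ext card_frames[OF assms(3) finW, of i] by (simp add: i_def n_def)
  finally have "card X = ?l" .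
  moreover have "inj_on (\<lambda>(us, vs). us @ vs) X"
    by (auto simp: inj_on_def X_def frames_def)
  moreover have "(\<lambda>(us, vs). us @ vs) ` X \<subseteq> ?B"
  proof clarify
    fix us vs assume "(us, vs) \<in> X"
    then have us: "us \<in> frames W (dim W)" "us @ vs \<in> frames U (dim U)"
      by (auto simp: X_def i_def n_def)
    then have "length us = dim W" by (simp add: frames_def)
    then show "us @ vs \<in> frames U (dim U) \<and> span (set (take (dim W) (us @ vs))) = W"
      using us span_frame[OF assms(3) finW us(1)] by simp
  qed
  ultimately show ?thesis
    using card_inj_on_le[of "\<lambda>(us, vs). us @ vs" X ?B] finite_frames[OF assms(2), of "dim U"]
    by simp
qed

text \<open>For \<open>i\<close> in \<open>I\<close> but not in \<open>J\<close>,
  \<open>b ! i\<close> would lie in the span of the other vectors of \<open>b\<close>. This reduces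
  containment of double chain members to their index sets.\<close>

lemma span_nth_subset_iff:
  assumes "independent (set b)" "distinct b" "I \<subseteq> {..<length b}" "J \<subseteq> {..<length b}"
  shows "span ((!) b ` I) \<subseteq> span ((!) b ` J) \<longleftrightarrow> I \<subseteq> J"
proof
  assume sub: "span ((!) b ` I) \<subseteq> span ((!) b ` J)"
  show "I \<subseteq> J"
  proof
    fix i assume i: "i \<in> I"
    show "i \<in> J"
    proof (rule ccontr)
      assume "i \<notin> J"
      have "(!) b ` J \<subseteq> set b - {b ! i}"
        using assms(2-4) i \<open>i \<notin> J\<close> by (auto simp: nth_eq_iff_index_eq subset_iff)
      then have "b ! i \<in> span (set b - {b ! i})"
        using sub i span_base[of "b ! i" "(!) b ` I"] span_mono by blast
      then show False using assms(1,3) i by (auto simp: dependent_def)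
    qed
  qed
qed (intro span_mono image_mono)

lemma permute_list_frames:
  "f permutes {..<k} \<Longrightarrow> b \<in> frames U k \<Longrightarrow> permute_list f b \<in> frames U k"
  by (auto simp: frames_def)

end


text \<open>The code \<open>2 n - 1\<close> is left out because \<open>B\<^sub>n\<close> would need an \<open>(n + 1)\<close>-st basis vector.\<close>

definition double_chain_positions :: "nat \<Rightarrow> nat set" where
  "double_chain_positions n = {..2 * n} - {2 * n - 1}"

lemma double_chain_index_bounded:
  "m \<in> double_chain_positions n \<Longrightarrow> double_chain_index m \<subseteq> {..<n}"
proof -
  assume m: "m \<in> double_chain_positions n"
  show ?thesis
  proof (cases "even m")
    case True
    then show ?thesis using m by (auto simp: double_chain_positions_def double_chain_index_def)
  next
    case False
    \<comment> \<open>The odd \<open>m\<close> is at most \<open>2 * n - 3\<close>, as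
      \<open>2 * n - 1\<close> is left out.\<close>
    then have "m div 2 + 1 < n"
      using m unfolding double_chain_positions_def by simp presburger
    then show ?thesis using False by (auto simp: double_chain_index_def)
  qed
qed

section \<open>Gaussian binomial coefficients\<close>

lemma power_minus_one_pos:
  assumes "2 \<le> (q :: nat)" "0 < k"
  shows "0 < real q ^ k - 1"
proof -
  have "1 < real q" using assms(1) by simp
  then show ?thesis using one_less_power[of "real q" k] assms(2) by simp
qed

text \<open>Reversing the denominators makes the factors independent of \<open>k\<close>, so that
  raising \<open>k\<close> by one appends a single factor.\<close>

lemma gauss_binomial_altdef:
  assumes "k \<le> n"
  shows "gauss_binomial q n k = (\<Prod>i<k. (real q ^ (n - i) - 1) / (real q ^ Suc i - 1))"
proof -
  have "(\<Prod>i<k. real q ^ (k - i) - 1) = (\<Prod>i<k. real q ^ Suc (k - Suc i) - 1)"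
    by (intro prod.cong) (auto simp: Suc_diff_Suc)
  also have "\<dots> = (\<Prod>i<k. real q ^ Suc i - 1)"
    by (rule prod.nat_diff_reindex[where g = "\<lambda>i. real q ^ Suc i - 1"])
  finally show ?thesis by (simp add: gauss_binomial_def prod_dividef)
qed

lemma gauss_binomial_Suc:
  "Suc k \<le> n \<Longrightarrow>
    gauss_binomial q n (Suc k) = gauss_binomial q n k * ((real q ^ (n - k) - 1) / (real q ^ Suc k - 1))"
  by (simp add: gauss_binomial_altdef)

lemma gauss_binomial_nonneg: "1 \<le> q \<Longrightarrow> 0 \<le> gauss_binomial q n k"
  unfolding gauss_binomial_def
  by (intro prod_nonneg ballI divide_nonneg_nonneg) (simp_all add: one_le_power)

text \<open>The ratio of the coefficients at \<open>k + 1\<close> and \<open>k\<close> is at least 1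
  for \<open>2 * k < n\<close> and at most 1 from there on, so the coefficients rise up to the
  middle and then fall.\<close>

lemma gauss_binomial_le_middle:
  assumes q: "2 \<le> q" and k: "k \<le> n"
  shows "gauss_binomial q n k \<le> gauss_binomial q n (n div 2)"
proof -
  have pos: "real q ^ Suc k - 1 > 0" for k
    by (rule power_minus_one_pos[OF q]) simp
  have up: "gauss_binomial q n k \<le> gauss_binomial q n (Suc k)" if "2 * k < n" for k
  proof -
    have "real q ^ Suc k \<le> real q ^ (n - k)" using that q by (intro power_increasing) auto
    then have "1 \<le> (real q ^ (n - k) - 1) / (real q ^ Suc k - 1)" using pos[of k] by simp
    then show ?thesis
      using mult_left_mono[of 1 "(real q ^ (n - k) - 1) / (real q ^ Suc k - 1)" "gauss_binomial q n k"]
        that q gauss_binomial_nonneg[of q n k] gauss_binomial_Suc[of k n q] by simp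
  qed
  have down: "gauss_binomial q n (Suc k) \<le> gauss_binomial q n k" if "k < n" "n \<le> Suc (2 * k)" for k
  proof -
    have "real q ^ (n - k) \<le> real q ^ Suc k" using that q by (intro power_increasing) auto
    then have "(real q ^ (n - k) - 1) / (real q ^ Suc k - 1) \<le> 1" using pos[of k] by simp
    then show ?thesis
      using mult_left_mono[of "(real q ^ (n - k) - 1) / (real q ^ Suc k - 1)" 1 "gauss_binomial q n k"]
        that q gauss_binomial_nonneg[of q n k] gauss_binomial_Suc[of k n q] by simp
  qed
  show ?thesis
  proof (cases "k \<le> n div 2")
    case True
    then show ?thesis
    proof (induction rule: inc_induct)
      case (step m)
      then show ?case using up[of m] by linarith
    qed simp
  next
    case False
    then have "n div 2 \<le> k" by simp
    then show ?thesis using k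
    proof (induction rule: dec_induct)
      case (step m)
      then show ?case using down[of m] by linarith
    qed simp
  qed
qed

lemma prod_lessThan_add:
  fixes f :: "nat \<Rightarrow> 'a::comm_monoid_mult"
  shows "(\<Prod>j<i + k. f j) = (\<Prod>j<i. f j) * (\<Prod>j<k. f (i + j))"
  by (induction k) (simp_all add: mult.assoc)

text \<open>The left side counts the ordered bases of an \<open>n\<close>-dimensional space, the
  last factor those beginning with a basis of a fixed \<open>i\<close>-dimensional subspace. For
  each \<open>j < i\<close> the powers \<open>q ^ j\<close> cancel, leaving a factor of the
  coefficient.\<close>

lemma gauss_binomial_frame_count:
  assumes q: "2 \<le> q" and i: "i \<le> n"
  shows "real (\<Prod>j<n. q ^ n - q ^ j)
    = gauss_binomial q n i * real ((\<Prod>j<i. q ^ i - q ^ j) * (\<Prod>j<n - i. q ^ n - q ^ (i + j)))"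
proof -
  have "real (q ^ n - q ^ j)
      = (real q ^ (n - j) - 1) / (real q ^ (i - j) - 1) * real (q ^ i - q ^ j)" if "j < i" for j
  proof -
    have "real q ^ (i - j) - 1 \<noteq> 0"
      using power_minus_one_pos[OF q, of "i - j"] that by simp
    moreover have "real (q ^ m - q ^ j) = real q ^ j * (real q ^ (m - j) - 1)" if "j \<le> m" for m
      using that q power_increasing[of j m q] by (simp add: of_nat_diff algebra_simps flip: power_add)
    ultimately show ?thesis using that i by simp
  qed
  then have "real (\<Prod>j<i. q ^ n - q ^ j) = gauss_binomial q n i * real (\<Prod>j<i. q ^ i - q ^ j)"
    unfolding gauss_binomial_def of_nat_prod prod.distrib[symmetric] by (intro prod.cong) auto
  then show ?thesis
    using prod_lessThan_add[of "\<lambda>j. q ^ n - q ^ j" i "n - i"] i by simp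
qed

section \<open>Averaging over double chains\<close>

lemma card_filter_eq_sum:
  "finite A \<Longrightarrow> card {x \<in> A. Q x} = (\<Sum>x\<in>A. if Q x then 1 else 0)"
  by (simp flip: sum.inter_filter)

context finite_field_space
begin

definition double_chain_member :: "'b list \<Rightarrow> nat \<Rightarrow> 'b set" where
  "double_chain_member b m = span ((!) b ` double_chain_index m)"

text \<open>In terms of a random frame, \<open>W\<close> of dimension \<open>i\<close> equals
  \<open>A\<^sub>i\<close> with probability at least the reciprocal of the coefficient.\<close>

lemma card_frames_le_even_member:
  assumes U: "subspace U" "finite U" and W: "subspace W" "W \<subseteq> U"
  shows "real (card (frames U (dim U)))
    \<le> gauss_binomial CARD('a) (dim U) (dim W)
      * real (card {b \<in> frames U (dim U). double_chain_member b (2 * dim W) = W})"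
proof -
  have le: "dim W \<le> dim U" using dim_subspace_mono[OF U W] .
  have finW: "finite W" using U(2) W(2) finite_subset by blast
  have "(!) b ` {..<dim W} = set (take (dim W) b)" if "b \<in> frames U (dim U)" for b
    using that le nth_image[of "dim W" b] by (simp add: frames_def lessThan_atLeast0)
  then have "{b \<in> frames U (dim U). double_chain_member b (2 * dim W) = W}
    = {b \<in> frames U (dim U). span (set (take (dim W) b)) = W}"
    by (auto simp: double_chain_member_def double_chain_index_def)
  then show ?thesis
    using card_frames_initial_span[OF U W] gauss_binomial_frame_count[OF CARD_scalars_ge_2 le]
      gauss_binomial_nonneg[of "CARD('a)" "dim U" "dim W"] CARD_scalars_ge_2
    unfolding card_frames[OF U] card_subspace[OF U] card_subspace[OF W(1) finW]
    by (simp add: mult_left_mono del: of_nat_mult of_nat_prod)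
qed

text \<open>Exchanging two consecutive vectors of a frame turns its even double chain member at a level
  into the odd one.\<close>

lemma card_even_member_le_odd_member:
  assumes "finite U" "0 < i" "i < n"
  shows "card {b \<in> frames U n. double_chain_member b (2 * i) = W}
    \<le> card {b \<in> frames U n. double_chain_member b (2 * i - 1) = W}" (is "card ?E \<le> card ?O")
proof (rule card_inj_on_le)
  \<comment> \<open>Counted from 0, these positions hold \<open>e\<^sub>i\<close> and
    \<open>e\<^sub>i\<^sub>+\<^sub>1\<close>, the vectors in which \<open>A\<^sub>i\<close> and
    \<open>B\<^sub>i\<close> differ.\<close>
  define f where "f = Transposition.transpose (i - 1) i"
  have f: "f permutes {..<n}" unfolding f_def using assms by (intro permutes_swap_id) auto
  have idx: "f ` double_chain_index (2 * i - 1) = double_chain_index (2 * i)"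
  proof -
    obtain k where k: "i = Suc k" using assms(2) gr0_implies_Suc by blast
    have "f ` {..<k} = {..<k}" using k by (force simp: f_def Transposition.transpose_def)
    then show ?thesis using k
      by (auto simp: double_chain_index_def f_def lessThan_Suc)
  qed
  show "inj_on (permute_list f) ?E"
  proof (rule inj_on_inverseI)
    fix b assume "b \<in> ?E"
    then have "length b = n" by (simp add: frames_def)
    then have "permute_list f (permute_list f b) = permute_list (f \<circ> f) b"
      using f by (simp add: permute_list_compose)
    then show "permute_list f (permute_list f b) = b" by (simp add: f_def)
  qed
  show "permute_list f ` ?E \<subseteq> ?O"
  proof clarify
    fix b assume b: "b \<in> frames U n"
    have len: "length b = n" using b by (simp add: frames_def)
    have "double_chain_index (2 * i - 1) \<subseteq> {..<n}"
      using assms by (intro double_chain_index_bounded) (auto simp: double_chain_positions_def)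
    then have "(!) (permute_list f b) ` double_chain_index (2 * i - 1)
      = (!) b ` f ` double_chain_index (2 * i - 1)"
      unfolding image_image using f len by (intro image_cong) (auto simp: permute_list_nth)
    then show "permute_list f b \<in> frames U n \<and>
        double_chain_member (permute_list f b) (2 * i - 1) = double_chain_member b (2 * i)"
      using permute_list_frames[OF f b] by (simp add: double_chain_member_def idx del: One_nat_def)
  qed
  show "finite ?O" using finite_frames[OF assms(1)] by simp
qed

text \<open>Double counting of the triples \<open>W\<close>, \<open>m\<close>, \<open>b\<close> with
  \<open>W\<close> in \<open>F\<close> equal to \<open>double_chain_member b m\<close>: every
  \<open>W\<close> occurs in at least \<open>2 * card B / G\<close> of them, every frame
  \<open>b\<close> in at most \<open>K\<close>.\<close>

lemma family_card_le_double_chain: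
  assumes U: "subspace U" "finite U" and n: "dim U = n" "2 \<le> n"
    and F: "\<And>W. W \<in> F \<Longrightarrow> subspace W \<and> W \<subseteq> U"
    and K: "\<And>b. b \<in> frames U n \<Longrightarrow>
      card {m \<in> double_chain_positions n. double_chain_member b m \<in> F} \<le> K"
  shows "real (card F) \<le> real K / 2 * gauss_binomial CARD('a) n (n div 2)"
proof -
  define B I where "B = frames U n" and "I = double_chain_positions n"
  define G where "G = gauss_binomial CARD('a) n (n div 2)"
  define c where "c W m = card {b \<in> B. double_chain_member b m = W}" for W m
  have finB: "finite B" using U finite_frames by (simp add: B_def)
  have finI: "finite I" by (simp add: I_def double_chain_positions_def)
  have finF: "finite F" using F U(2) finite_subset[of F "Pow U"] by auto
  have T: "0 < card B"
  proof -
    have "CARD('a) ^ j < CARD('a) ^ n" if "j < n" for j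
      using that CARD_scalars_ge_2 by simp
    then show ?thesis using n by (simp add: B_def card_frames[OF U] card_subspace[OF U])
  qed
  \<comment> \<open>This compensates for the zero space and \<open>U\<close>, which have only one
    position each. It is here that \<open>2 \<le> n\<close> enters, through the coefficient of
    \<open>n\<close> and 1.\<close>
  have G2: "2 \<le> G"
  proof -
    have q: "2 \<le> real CARD('a)" using CARD_scalars_ge_2 by simp
    have "real CARD('a) ^ 2 \<le> real CARD('a) ^ n" using q n by (intro power_increasing) auto
    moreover have "2 * real CARD('a) \<le> real CARD('a) ^ 2"
      using q by (simp add: power2_eq_square)
    ultimately have "2 * (real CARD('a) - 1) \<le> real CARD('a) ^ n - 1" by simp
    then have "2 \<le> gauss_binomial CARD('a) n 1"
      using q by (simp add: gauss_binomial_def field_simps)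
    then show ?thesis
      using gauss_binomial_le_middle[OF CARD_scalars_ge_2, of 1 n] n by (simp add: G_def)
  qed
  have weight: "2 * real (card B) \<le> G * real (\<Sum>m\<in>I. c W m)" if "W \<in> F" for W
  proof -
    define i where "i = dim W"
    have W: "subspace W" "W \<subseteq> U" using F that by auto
    have i: "i \<le> n" using dim_subspace_mono[OF U W] n by (simp add: i_def)
    have even: "real (card B) \<le> gauss_binomial CARD('a) n i * real (c W (2 * i))"
      using card_frames_le_even_member[OF U W] n by (simp add: B_def c_def i_def)
    show ?thesis
    proof (cases "0 < i \<and> i < n")
      case True
      have "real (card B) \<le> G * real (c W (2 * i))"
        using even gauss_binomial_le_middle[OF CARD_scalars_ge_2 i] G_def
        by (meson mult_right_mono of_nat_0_le_iff order_trans)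
      moreover have "c W (2 * i) \<le> c W (2 * i - 1)"
        using card_even_member_le_odd_member[OF U(2)] True by (simp add: B_def c_def)
      moreover have "c W (2 * i - 1) + c W (2 * i) \<le> (\<Sum>m\<in>I. c W m)"
      proof -
        have "2 * i - 1 \<noteq> 2 * i" using True by auto
        then have "c W (2 * i - 1) + c W (2 * i) = (\<Sum>m\<in>{2 * i - 1, 2 * i}. c W m)" by simp
        also have "\<dots> \<le> (\<Sum>m\<in>I. c W m)"
          using True finI by (intro sum_mono2) (auto simp: I_def double_chain_positions_def)
        finally show ?thesis .
      qed
      ultimately have "2 * c W (2 * i) \<le> (\<Sum>m\<in>I. c W m)" "real (card B) \<le> G * real (c W (2 * i))"
        by linarith+
      then have "G * (2 * real (c W (2 * i))) \<le> G * real (\<Sum>m\<in>I. c W m)"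
        using G2 by (intro mult_left_mono) linarith+
      then show ?thesis using \<open>real (card B) \<le> G * real (c W (2 * i))\<close> by simp
    next
      case False
      then have "i = 0 \<or> i = n" using i by auto
      moreover have "gauss_binomial CARD('a) n n = 1"
      proof -
        have "real CARD('a) ^ (n - j) - 1 \<noteq> 0" if "j < n" for j
          using that power_minus_one_pos[OF CARD_scalars_ge_2, of "n - j"] by simp
        then show ?thesis by (simp add: gauss_binomial_def)
      qed
      ultimately have "gauss_binomial CARD('a) n i = 1" by (auto simp: gauss_binomial_def)
      then have "card B \<le> c W (2 * i)" using even by simp
      also have "2 * i \<in> I"
        using \<open>i = 0 \<or> i = n\<close> n by (auto simp: I_def double_chain_positions_def)
      then have "c W (2 * i) \<le> (\<Sum>m\<in>I. c W m)" using finI by (intro member_le_sum) auto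
      finally have "real (card B) \<le> real (\<Sum>m\<in>I. c W m)" by (simp del: of_nat_sum)
      then show ?thesis using G2 by (intro mult_mono) auto
    qed
  qed
  have "(\<Sum>W\<in>F. \<Sum>m\<in>I. c W m) = (\<Sum>b\<in>B. card {m \<in> I. double_chain_member b m \<in> F})"
  proof -
    have "(\<Sum>W\<in>F. \<Sum>m\<in>I. c W m)
      = (\<Sum>W\<in>F. \<Sum>m\<in>I. \<Sum>b\<in>B. if double_chain_member b m = W then 1 else 0)"
      unfolding c_def by (simp only: card_filter_eq_sum[OF finB])
    also have "\<dots> = (\<Sum>m\<in>I. \<Sum>b\<in>B. \<Sum>W\<in>F. if double_chain_member b m = W then 1 else 0)"
      by (subst sum.swap, rule sum.cong[OF refl], rule sum.swap)
    also have "\<dots> = (\<Sum>m\<in>I. \<Sum>b\<in>B. if double_chain_member b m \<in> F then 1 else 0)"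
      using finF by simp
    also have "\<dots> = (\<Sum>b\<in>B. \<Sum>m\<in>I. if double_chain_member b m \<in> F then 1 else 0)"
      by (rule sum.swap)
    finally show ?thesis by (simp only: card_filter_eq_sum[OF finI])
  qed
  also have "\<dots> \<le> card B * K"
    using sum_bounded_above[of B _ K] K by (simp add: B_def I_def)
  finally have total: "real (\<Sum>W\<in>F. \<Sum>m\<in>I. c W m) \<le> real (card B * K)"
    by (simp only: of_nat_le_iff)
  have "real (card F) * (2 * real (card B)) = (\<Sum>W\<in>F. 2 * real (card B))"
    by simp
  also have "\<dots> \<le> (\<Sum>W\<in>F. G * real (\<Sum>m\<in>I. c W m))"
    by (rule sum_mono[OF weight])
  also have "\<dots> = G * real (\<Sum>W\<in>F. \<Sum>m\<in>I. c W m)"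
    by (simp add: sum_distrib_left)
  also have "\<dots> \<le> G * real (card B * K)" using total G2 by (intro mult_left_mono) auto
  finally have "real (card B) * (2 * real (card F)) \<le> real (card B) * (real K * G)"
    by (simp add: algebra_simps)
  then have "2 * real (card F) \<le> real K * G" using T by simp
  then show ?thesis by (simp add: G_def)
qed

section \<open>Subposet-free families\<close>

text \<open>Otherwise \<open>F\<close> would occupy at least \<open>card P + height P le - 1\<close>
  positions, and the graded embedding into these codes would carry over to members of
  \<open>F\<close>. The 2 stands on the left to avoid truncated subtraction.\<close>

lemma double_chain_free_card:
  assumes P: "finite P" "partial_order_on P le"
    and b: "b \<in> frames U n"
    and free: "\<not> is_subposet P le F (relation_of (\<subseteq>) F)"
  shows "card {m \<in> double_chain_positions n. double_chain_member b m \<in> F} + 2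
    \<le> card P + height P le"
proof (rule ccontr)
  define S where "S = {m \<in> double_chain_positions n. double_chain_member b m \<in> F}"
  have finS: "finite S" by (simp add: S_def double_chain_positions_def)
  assume "\<not> ?thesis"
  then have card: "card P + height P le \<le> card S + 1" unfolding S_def by linarith
  obtain r where r: "\<And>x. x \<in> P \<Longrightarrow> r x < height P le"
    "\<And>x y. (x, y) \<in> le \<Longrightarrow> x \<noteq> y \<Longrightarrow> r x < (r y :: nat)"
    using height_grading[OF P] by metis
  \<comment> \<open>Only the strict part of \<open>le\<close> is used, since
    \<open>double_chain_less\<close> is irreflexive.\<close>
  have "\<exists>\<phi>. inj_on \<phi> P \<and> \<phi> ` P \<subseteq> S \<and>
    (\<forall>x\<in>P. \<forall>y\<in>P. (x, y) \<in> le \<and> x \<noteq> y \<longrightarrow> double_chain_less (\<phi> x) (\<phi> y))"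
    by (rule double_chain_embedding_graded[OF P(1) finS card, where r = r]) (use r in auto)
  then obtain \<phi> where \<phi>: "inj_on \<phi> P" "\<phi> ` P \<subseteq> S"
    "\<forall>x\<in>P. \<forall>y\<in>P. (x, y) \<in> le \<and> x \<noteq> y \<longrightarrow> double_chain_less (\<phi> x) (\<phi> y)"
    by (elim exE conjE)
  have iff: "double_chain_member b m \<subseteq> double_chain_member b m'
      \<longleftrightarrow> double_chain_index m \<subseteq> double_chain_index m'"
    if "m \<in> S" "m' \<in> S" for m m'
    unfolding double_chain_member_def
    using b that double_chain_index_bounded
    by (intro span_nth_subset_iff) (auto simp: frames_def S_def)
  have "inj_on (double_chain_member b) S"
  proof (rule inj_onI)
    fix m m' assume "m \<in> S" "m' \<in> S" "double_chain_member b m = double_chain_member b m'"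
    then have "double_chain_index m = double_chain_index m'" using iff by (metis order_eq_iff)
    then show "m = m'" using inj_double_chain_index by (rule injD[rotated])
  qed
  then have "inj_on (double_chain_member b \<circ> \<phi>) P"
    using \<phi>(1,2) by (intro comp_inj_on) (auto intro: inj_on_subset)
  moreover have "(double_chain_member b \<circ> \<phi>) ` P \<subseteq> F" using \<phi>(2) by (auto simp: S_def)
  moreover have "double_chain_member b (\<phi> x) \<subseteq> double_chain_member b (\<phi> y)"
    if "x \<in> P" "y \<in> P" "(x, y) \<in> le" for x y
  proof (cases "x = y")
    case False
    then have "double_chain_index (\<phi> x) \<subseteq> double_chain_index (\<phi> y)"
      using \<phi>(3) that double_chain_index_mono by blast
    then show ?thesis using iff \<phi>(2) that by blast
  qed simp
  ultimately have "is_subposet P le F (relation_of (\<subseteq>) F)"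
    unfolding is_subposet_def relation_of_def
    by (intro exI[of _ "double_chain_member b \<circ> \<phi>"]) auto
  with free show False by contradiction
qed

lemma card_subposet_free_family_le:
  assumes "finite P" "partial_order_on P le" "P \<noteq> {}"
    and U: "subspace U" "finite U" "2 \<le> dim U"
    and F: "\<And>W. W \<in> F \<Longrightarrow> subspace W \<and> W \<subseteq> U"
    and free: "\<not> is_subposet P le F (relation_of (\<subseteq>) F)"
  shows "real (card F) \<le> ((real (card P) + real (height P le)) / 2 - 1)
    * gauss_binomial CARD('a) (dim U) (dim U div 2)"
proof -
  define K where "K = card P + height P le - 2"
  \<comment> \<open>Size and height are positive, so the subtraction in \<open>K\<close> is not
    truncated.\<close>
  have "1 \<le> card P" using assms(1,3) by (simp add: Suc_le_eq card_gt_0_iff)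
  moreover have "1 \<le> height P le"
    using height_grading[OF assms(1,2)] assms(3)
    by (metis One_nat_def Suc_leI ex_in_conv not_gr_zero not_less_zero)
  ultimately have "real K / 2 = (real (card P) + real (height P le)) / 2 - 1"
    by (simp add: K_def of_nat_diff)
  moreover have "real (card F) \<le> real K / 2 * gauss_binomial CARD('a) (dim U) (dim U div 2)"
  proof (rule family_card_le_double_chain[OF U(1,2) refl U(3) F])
    fix b assume "b \<in> frames U (dim U)"
    then show "card {m \<in> double_chain_positions (dim U). double_chain_member b m \<in> F} \<le> K"
      using double_chain_free_card[OF assms(1,2) _ free] by (fastforce simp: K_def)
  qed
  ultimately show ?thesis by (simp only:)
qed

end

section \<open>The coordinate space\<close>

interpretation coord: finite_field_space "fscale :: 'a::{field,finite} \<Rightarrow> (nat \<Rightarrow> 'a) \<Rightarrow> nat \<Rightarrow> 'a"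
  by unfold_locales

theorem theorem16:
  fixes q :: nat and P :: "'p set" and le :: "'p rel"
  assumes "primepow q" and "CARD('a::{field,finite}) = q"
    and "finite P" and "P \<noteq> {}" and "partial_order_on P le"
  shows "\<forall>\<^sub>F n in sequentially.
    real (La_q TYPE('a) n P le)
      \<le> ((real (card P) + real (height P le)) / 2 - 1) * gauss_binomial q n (n div 2)"
  using eventually_ge_at_top[of 2]
proof eventually_elim
  fix n :: nat assume n: "2 \<le> n"
  define \<G> where "\<G> = {\<F>. \<F> \<subseteq> (subspaces n :: (nat \<Rightarrow> 'a) set set) \<and>
    \<not> is_subposet P le \<F> (relation_of (\<subseteq>) \<F>)}"
  define V where "V = (coord_space n :: (nat \<Rightarrow> 'a) set)"
  have V: "fvs.subspace V" "fvs.dim V = n"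
    by (simp_all add: V_def subspace_coord_space dim_coord_space)
  have "finite V"
  proof -
    obtain B where B: "fvs.independent B" "V \<subseteq> fvs.span B" "card B = n"
      using fvs.basis_exists V(2) by metis
    \<comment> \<open>An infinite set has \<open>card\<close> 0, so \<open>2 \<le> n\<close> forces
      \<open>B\<close> to be finite.\<close>
    then show ?thesis using n coord.card_span(1)[of B] card.infinite finite_subset by fastforce
  qed
  have "finite \<G>"
    unfolding \<G>_def by (rule finite_subset[OF _ finite_Pow_iff[THEN iffD2, OF finite_subspaces]]) auto
  \<comment> \<open>A nonempty \<open>P\<close> does not embed into the empty family, so the maximum
    is over a nonempty set and is attained.\<close>
  moreover have "{} \<in> \<G>" using assms(4) by (auto simp: \<G>_def is_subposet_def)
  ultimately have "Max (card ` \<G>) \<in> card ` \<G>" by (intro Max_in) auto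
  then obtain \<F> where \<F>: "\<F> \<in> \<G>" "La_q TYPE('a) n P le = card \<F>"
    by (auto simp: La_q_def \<G>_def)
  show "real (La_q TYPE('a) n P le)
      \<le> ((real (card P) + real (height P le)) / 2 - 1) * gauss_binomial q n (n div 2)"
    using coord.card_subposet_free_family_le[OF assms(3,5,4) V(1) \<open>finite V\<close>, of \<F>] \<F> n V(2) assms(2)
    by (auto simp: \<G>_def subspaces_def V_def)
qed

end
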